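(* Let $m\ge1$. Let $\widehat{\mathcal W}_i$, $\widehat{\mathcal W}^*_i$ and $\widehat{\mathcal B}_i$ be the subsets of $\mathcal W_i$, $\mathcal W^*_i$ and $\mathcal B_i$ consisting of trees in which all vertex degrees are multiples of $m$. Then there is a degree-preserving bijection between $\widehat{\mathcal W}_{m-1}$ and the disjoint union $\widehat{\mathcal W}^*_{m-1}\cup\widehat{\mathcal B}_{m+1}$.
   Context: All maps are planar, connected, considered up to orientation-preserving homeomorphism, and bipartite: vertices are black or white and each edge joins a black and a white vertex. Maps may carry half-edges attached to single vertices and lying in the infinite face. A half-edge at a white vertex is a leaf; one at a black vertex is a bud. Maps are rooted at a half-edge. Degrees count edges and half-edges. Degree-preserving means preserving the pair of multisets of degrees of white and of black vertices. A tree is such a map with a single face. Its charge is the number of leaves minus the number of buds, not counting the root half-edge; the total charge counts it. For an edge $e$ of a tree $T$, cutting $e$ into a leaf at its white end and a bud at its black end yields $T_e^\bullet$ (containing the black end) and $T_e^\circ$ (containing the white end), each rooted at its new half-edge. The lower subtree at $e$ is the one not containing the root. A blossom tree is a tree such that, for every edge $e$: the lower subtree has charge $\ge0$ if it is $T_e^\circ$, and $\le1$ if it is $T_e^\bullet$. For a tree of total charge $k\ge1$, go counterclockwise around it and repeatedly match a bud immediately followed (among still unmatched half-edges in the cyclic order) by a leaf. The $k$ leaves left unmatched are single. A tree rooted at a leaf is balanced if its root is single. $\mathcal W_i$ is the set of blossom trees of charge $i$ rooted at a leaf. $\mathcal B_i$ is the set of blossom trees of charge $i$ rooted at a bud. $\mathcal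 W_i^*$ is the set of balanced trees in $\mathcal W_i$. *)

theory Defs
  imports "HOL-Combinatorics.Orbits" "HOL-Library.Multiset"
begin

text \<open>
  Bipartite planar maps with half-edges, rooted at a half-edge, are encoded as combinatorial
  maps. A dart is an edge-end attached to a vertex (a half-edge is a single dart).
  The permutation \<open>rot\<close> sends a dart to the next one in counterclockwise order
  around its vertex, and the involution \<open>opp\<close> exchanges the two darts of an edge and fixes
  half-edges. Vertices are the cycles of \<open>rot\<close>; \<open>white d\<close> is the colour of the vertex
  carrying \<open>d\<close>. Maps up to orientation-preserving homeomorphism are then combinatorial maps
  up to rooted isomorphism; as maps are finite, natural numbers suffice as darts.
\<close>

record cmap =
  darts :: "nat set"
  rot :: "nat \<Rightarrow> nat"
  opp :: "nat \<Rightarrow> nat"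
  white :: "nat \<Rightarrow> bool"
  root_dart :: nat

definition vertices :: "cmap \<Rightarrow> nat set set" where
  "vertices M = (\<lambda>d. orbit (rot M) d) ` darts M"

definition edges :: "cmap \<Rightarrow> nat set set" where
  "edges M = {{d, opp M d} | d. d \<in> darts M \<and> opp M d \<noteq> d}"

definition half_edges :: "cmap \<Rightarrow> nat set" where
  "half_edges M = {d \<in> darts M. opp M d = d}"

definition leaves :: "cmap \<Rightarrow> nat set" where
  "leaves M = {d \<in> half_edges M. white M d}"

definition buds :: "cmap \<Rightarrow> nat set" where
  "buds M = {d \<in> half_edges M. \<not> white M d}"

text \<open>
  One step of the walk along a face: follow the edge of \<open>d\<close> to its other end, then take the
  next dart counterclockwise. The walk keeps its face on the right, so that along the
  single face of a tree it goes counterclockwise around the tree.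
\<close>

definition walk :: "cmap \<Rightarrow> nat \<Rightarrow> nat" where
  "walk M d = rot M (opp M d)"

definition faces :: "cmap \<Rightarrow> nat set set" where
  "faces M = (\<lambda>d. orbit (walk M) d) ` darts M"

definition component :: "cmap \<Rightarrow> nat \<Rightarrow> nat set" where
  "component M d = {d'. (d, d') \<in> {(x, y). y = rot M x \<or> y = opp M x}\<^sup>*}"

text \<open>
  Planarity is Euler's relation. The infinite face is the one containing the root,
  hence all half-edges.
\<close>

definition rooted_map :: "cmap \<Rightarrow> bool" where
  "rooted_map M \<longleftrightarrow>
     finite (darts M) \<and> rot M permutes darts M \<and>
     opp M permutes darts M \<and> (\<forall>d. opp M (opp M d) = d) \<and>
     (\<forall>d \<in> darts M. white M (rot M d) = white M d) \<and>
     (\<forall>d \<in> darts M. opp M d \<noteq> d \<longrightarrow> white M (opp M d) \<noteq> white M d) \<and>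
     (\<forall>d \<in> darts M. component M d = darts M) \<and>
     card (vertices M) + card (faces M) = card (edges M) + 2 \<and>
     root_dart M \<in> half_edges M \<and>
     half_edges M \<subseteq> orbit (walk M) (root_dart M)"

definition is_iso :: "(nat \<Rightarrow> nat) \<Rightarrow> cmap \<Rightarrow> cmap \<Rightarrow> bool" where
  "is_iso h M N \<longleftrightarrow>
     bij_betw h (darts M) (darts N) \<and>
     (\<forall>d \<in> darts M. h (rot M d) = rot N (h d) \<and> h (opp M d) = opp N (h d) \<and>
                    white N (h d) = white M d) \<and>
     h (root_dart M) = root_dart N"

definition map_iso :: "(cmap \<times> cmap) set" where
  "map_iso = {(M, N). rooted_map M \<and> rooted_map N \<and> (\<exists>h. is_iso h M N)}"

lemma equiv_map_iso: "equiv {M. rooted_map M} map_iso"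
proof (rule equivI)
  show "map_iso \<subseteq> {M. rooted_map M} \<times> {M. rooted_map M}"
    by (auto simp: map_iso_def)
  show "refl_on {M. rooted_map M} map_iso"
    by (auto simp: refl_on_def map_iso_def is_iso_def intro!: exI[of _ id])
  show "sym map_iso"
  proof (rule symI)
    fix M N assume "(M, N) \<in> map_iso"
    then obtain h where M: "rooted_map M" and N: "rooted_map N" and h: "is_iso h M N"
      by (auto simp: map_iso_def)
    let ?g = "inv_into (darts M) h"
    have bij: "bij_betw h (darts M) (darts N)" using h by (simp add: is_iso_def)
    have closed: "rot M d \<in> darts M" "opp M d \<in> darts M" if "d \<in> darts M" for d
      using M that unfolding rooted_map_def by (metis permutes_in_image)+
    have left_inv: "?g (h d) = d" if "d \<in> darts M" for d
      using bij that by (simp add: bij_betw_inv_into_left)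
    have "?g (rot N d) = rot M (?g d) \<and> ?g (opp N d) = opp M (?g d) \<and>
          white M (?g d) = white N d" if "d \<in> darts N" for d
    proof -
      have "d \<in> h ` darts M" using bij that by (simp add: bij_betw_imp_surj_on)
      then obtain c where c: "c \<in> darts M" "d = h c" by (rule imageE)
      have "rot N d = h (rot M c)" "opp N d = h (opp M c)" "white N d = white M c"
        using h c unfolding is_iso_def by metis+
      then show ?thesis using c closed[OF c(1)] left_inv by simp
    qed
    moreover have "?g (root_dart N) = root_dart M"
    proof -
      have "root_dart M \<in> darts M" using M by (simp add: rooted_map_def half_edges_def)
      moreover have "root_dart N = h (root_dart M)" using h by (simp add: is_iso_def)
      ultimately show ?thesis by (simp add: left_inv)
    qed
    ultimately have "is_iso ?g N M"
      using bij by (simp add: is_iso_def bij_betw_inv_into)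
    then show "(N, M) \<in> map_iso" using M N by (auto simp: map_iso_def)
  qed
  show "trans map_iso"
  proof (rule transI)
    fix L M N assume "(L, M) \<in> map_iso" "(M, N) \<in> map_iso"
    then obtain g h where L: "rooted_map L" and N: "rooted_map N"
      and g: "is_iso g L M" and h: "is_iso h M N"
      by (auto simp: map_iso_def)
    have "g d \<in> darts M" if "d \<in> darts L" for d
      using g that by (auto simp: is_iso_def bij_betw_def)
    then have "is_iso (h \<circ> g) L N"
      using g h by (auto simp: is_iso_def intro: bij_betw_trans)
    then show "(L, N) \<in> map_iso" using L N by (auto simp: map_iso_def)
  qed
qed

definition white_degrees :: "cmap \<Rightarrow> nat multiset" where
  "white_degrees M = image_mset card (mset_set {v \<in> vertices M. \<forall>d \<in> v. white M d})"

definition black_degrees :: "cmap \<Rightarrow> nat multiset" where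
  "black_degrees M = image_mset card (mset_set {v \<in> vertices M. \<forall>d \<in> v. \<not> white M d})"

definition degrees_multiples_of :: "nat \<Rightarrow> cmap \<Rightarrow> bool" where
  "degrees_multiples_of m M \<longleftrightarrow> (\<forall>v \<in> vertices M. m dvd card v)"

definition tree :: "cmap \<Rightarrow> bool" where
  "tree M \<longleftrightarrow> rooted_map M \<and> card (faces M) = 1"

definition charge :: "cmap \<Rightarrow> int" where
  "charge M = int (card (leaves M - {root_dart M})) - int (card (buds M - {root_dart M}))"

definition total_charge :: "cmap \<Rightarrow> int" where
  "total_charge M = int (card (leaves M)) - int (card (buds M))"

text \<open>
  \<open>cut M d\<close> replaces the edge of \<open>d\<close> by half-edges at its two ends, and \<open>side M d\<close> is the part
  containing \<open>d\<close>, rooted at the new half-edge \<open>d\<close>: for an edge \<open>e\<close> of a tree \<open>T\<close>, it is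
  \<open>T\<^sub>e\<^sup>\<circ>\<close> if \<open>d\<close> is the white end of \<open>e\<close> and \<open>T\<^sub>e\<^sup>\<bullet>\<close> if it is the black end.
\<close>

definition cut :: "cmap \<Rightarrow> nat \<Rightarrow> cmap" where
  "cut M d = M\<lparr>opp := (opp M)(d := d, opp M d := opp M d)\<rparr>"

definition side :: "cmap \<Rightarrow> nat \<Rightarrow> cmap" where
  "side M d =
     (let D = component (cut M d) d in
      \<lparr>darts = D, rot = perm_restrict (rot M) D, opp = perm_restrict (opp (cut M d)) D,
       white = white M, root_dart = d\<rparr>)"

definition blossom_tree :: "cmap \<Rightarrow> bool" where
  "blossom_tree M \<longleftrightarrow> tree M \<and>
     (\<forall>d \<in> darts M. opp M d \<noteq> d \<longrightarrow> root_dart M \<notin> darts (side M d) \<longrightarrow>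
        (if white M d then charge (side M d) \<ge> 0 else charge (side M d) \<le> 1))"

text \<open>
  \<open>followed_by M U b l\<close>: going counterclockwise from \<open>b\<close>, the first element of \<open>U\<close> met is \<open>l\<close>.
  \<open>unmatched M U\<close>: \<open>U\<close> is the set of half-edges left unmatched at some stage of the
  matching process.
\<close>

definition followed_by :: "cmap \<Rightarrow> nat set \<Rightarrow> nat \<Rightarrow> nat \<Rightarrow> bool" where
  "followed_by M U b l \<longleftrightarrow> l \<in> U \<and>
     (\<exists>n>0. (walk M ^^ n) b = l \<and> (\<forall>j. 0 < j \<and> j < n \<longrightarrow> (walk M ^^ j) b \<notin> U))"

inductive unmatched :: "cmap \<Rightarrow> nat set \<Rightarrow> bool" for M :: cmap where
  start: "unmatched M (half_edges M)"
| match: "unmatched M U \<Longrightarrow> b \<in> U \<inter> buds M \<Longrightarrow> l \<in> U \<inter> leaves M \<Longrightarrow> followed_by M U b l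
           \<Longrightarrow> unmatched M (U - {b, l})"

definition single :: "cmap \<Rightarrow> nat \<Rightarrow> bool" where
  "single M l \<longleftrightarrow> l \<in> leaves M \<and>
     (\<exists>U. unmatched M U \<and> l \<in> U \<and>
          \<not> (\<exists>b \<in> U \<inter> buds M. \<exists>l' \<in> U \<inter> leaves M. followed_by M U b l'))"

definition balanced :: "cmap \<Rightarrow> bool" where
  "balanced M \<longleftrightarrow> total_charge M \<ge> 1 \<and> single M (root_dart M)"

text \<open>The families of blossom trees, as sets of isomorphism classes.\<close>

definition \<W> :: "int \<Rightarrow> cmap set set" where
  "\<W> i = {M. blossom_tree M \<and> root_dart M \<in> leaves M \<and> charge M = i} // map_iso"

definition \<B> :: "int \<Rightarrow> cmap set set" where
  "\<B> i = {M. blossom_tree M \<and> root_dart M \<in> buds M \<and> charge M = i} // map_iso"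

definition \<W>_star :: "int \<Rightarrow> cmap set set" where
  "\<W>_star i = {T \<in> \<W> i. \<forall>M \<in> T. balanced M}"

definition hat :: "nat \<Rightarrow> cmap set set \<Rightarrow> cmap set set" where
  "hat m X = {T \<in> X. \<forall>M \<in> T. degrees_multiples_of m M}"

definition degree_preserving :: "cmap set set \<Rightarrow> (cmap set \<Rightarrow> cmap set) \<Rightarrow> bool" where
  "degree_preserving X f \<longleftrightarrow>
     (\<forall>T \<in> X. \<forall>M \<in> T. \<forall>N \<in> f T.
        white_degrees N = white_degrees M \<and> black_degrees N = black_degrees M)"

end

theory Submission
  imports Defs
begin

text \<open>
  Reroot an unbalanced tree at the bud matched with its root, and, conversely, a tree rooted at a
  bud at the leaf matched with that bud. The total charge is \<open>m\<close> on both sides, hence positive, so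
  that every bud is matched. The matching does not see the root, and for trees of total charge
  \<open>m\<close> with degrees divisible by \<open>m\<close> neither does the blossom condition: each side of an edge
  imposes the same bound.

  To see that the outcome of the matching process does not depend on its order, give buds height
  \<open>+1\<close> and leaves height \<open>-1\<close>: a bud is always matched with the leaf at which the height along
  the walk around the tree first returns to zero.
\<close>

section \<open>The matching\<close>

text \<open>The matching is first recast as a relation \<open>matched\<close> given by heights
  alone, with neither a root nor an order of steps in it. It is therefore untouched by rerooting and
  carried along by isomorphisms. The link with the process is an invariant: every half-edge removed
  so far is an end of an arch on which nothing is left. The real obstacle is the blossom condition,
  because moving the root changes which side of an edge is the lower one. The bounds 0 and 1 alone
  do not survive this: a white side of charge \<open>c >= 0\<close> faces a black side of charge
  \<open>m - c\<close>, which may exceed 1. Divisibility of the degrees closes the gap. Within one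
  side, the darts at white vertices and those at black vertices are both multiples of
  \<open>m\<close> in number, and the inner edges cancel in their difference; so the charge is known
  modulo \<open>m\<close>, and no \<open>c\<close> from 0 to \<open>m - 2\<close> can occur. On
  isomorphism classes the map is well defined because partners in the matching are unique.\<close>

definition weight :: "cmap \<Rightarrow> nat \<Rightarrow> int" where
  "weight M d = of_bool (d \<in> buds M) - of_bool (d \<in> leaves M)"

definition height :: "cmap \<Rightarrow> nat \<Rightarrow> nat \<Rightarrow> int" where
  "height M d n = (\<Sum>j<n. weight M ((walk M ^^ j) d))"

text \<open>A first return to height zero. Since \<open>height M b n\<close> sums over the positions
  before \<open>n\<close>, the leaf at position \<open>n\<close> is counted only in
  \<open>height M b (Suc n)\<close>.\<close>

definition arch :: "cmap \<Rightarrow> nat \<Rightarrow> nat \<Rightarrow> bool" where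
  "arch M b n \<longleftrightarrow> b \<in> buds M \<and> height M b (Suc n) = 0 \<and> (\<forall>j. 0 < j \<and> j \<le> n \<longrightarrow> height M b j > 0)"

definition matched :: "cmap \<Rightarrow> nat \<Rightarrow> nat \<Rightarrow> bool" where
  "matched M b l \<longleftrightarrow> (\<exists>n. arch M b n \<and> l = (walk M ^^ n) b)"

lemma height_Suc: "height M d (Suc n) = height M d n + weight M ((walk M ^^ n) d)"
  by (simp add: height_def)

lemma height_add: "height M d (i + j) = height M d i + height M ((walk M ^^ i) d) j"
  by (induction j) (simp_all add: height_def funpow_add add.commute[of i])

lemma height_Suc_left: "height M d (Suc n) = weight M d + height M (walk M d) n"
  using height_add[of M d 1 n] by (simp add: height_def)

lemma half_edges_split: "half_edges M = leaves M \<union> buds M" "leaves M \<inter> buds M = {}"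
  by (auto simp: leaves_def buds_def)

lemma weight_simps:
  "b \<in> buds M \<Longrightarrow> weight M b = 1"
  "l \<in> leaves M \<Longrightarrow> weight M l = -1"
  by (auto simp: weight_def leaves_def buds_def)

lemma arch_end_leaf:
  assumes "arch M b n"
  shows "(walk M ^^ n) b \<in> leaves M" "0 < n"
proof -
  have b: "b \<in> buds M" and z: "height M b (Suc n) = 0"
    using assms by (auto simp: arch_def)
  show n: "0 < n"
  proof (rule ccontr)
    assume "\<not> 0 < n"
    then show False using z weight_simps(1)[OF b] by (simp add: height_def)
  qed
  then have "height M b n > 0" using assms by (auto simp: arch_def)
  then have "weight M ((walk M ^^ n) b) < 0" using z by (simp add: height_Suc)
  then show "(walk M ^^ n) b \<in> leaves M" by (auto simp: weight_def of_bool_def split: if_splits)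
qed

lemma arch_unique: "arch M b n \<Longrightarrow> arch M b n' \<Longrightarrow> n = n'"
proof (induction n n' rule: linorder_wlog)
  case (le n n')
  then have "\<not> Suc n \<le> n'" by (fastforce simp: arch_def)
  then show ?case using le by simp
qed simp

lemma matched_bud: "matched M b l \<Longrightarrow> b \<in> buds M"
  and matched_leaf: "matched M b l \<Longrightarrow> l \<in> leaves M"
  using arch_end_leaf by (auto simp: matched_def arch_def)

lemma matched_unique_leaf: "matched M b l \<Longrightarrow> matched M b l' \<Longrightarrow> l = l'"
  using arch_unique by (auto simp: matched_def)

lemma funpow_inj_cancel:
  assumes "inj f" "i \<le> j" "(f ^^ i) x = (f ^^ j) y"
  shows "x = (f ^^ (j - i)) y"
proof -
  have "(f ^^ i) x = (f ^^ i) ((f ^^ (j - i)) y)"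
    using funpow_add[of i "j - i" f] assms(2,3) by simp
  moreover have "inj (f ^^ i)" using assms(1) by (rule inj_fn)
  ultimately show ?thesis by (simp add: inj_eq)
qed

text \<open>Run backwards from the common end, the shorter arch is a final piece of the longer one.
  That piece contributes zero, so the longer arch would already have height zero where the shorter
  one starts, against positivity, unless both start together.\<close>

lemma arch_same_end:
  assumes inj: "inj (walk M)" and "arch M b n" "arch M b' n'" "(walk M ^^ n) b = (walk M ^^ n') b'"
  shows "b = b'"
  using assms(2-)
proof (induction n n' arbitrary: b b' rule: linorder_wlog)
  case (le n n')
  have b: "b = (walk M ^^ (n' - n)) b'" using funpow_inj_cancel[OF inj le(1)] le.prems by simp
  have "n' = n"
  proof (rule ccontr)
    assume "n' \<noteq> n"
    then have "0 < n' - n" "n' - n \<le> n'" using le by auto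
    then have "height M b' (n' - n) > 0" using le.prems by (auto simp: arch_def)
    moreover have "height M b' (Suc n') = height M b' (n' - n) + height M b (Suc n)"
      using height_add[of M b' "n' - n" "Suc n"] le(1) b by simp
    ultimately show False using le.prems by (simp add: arch_def)
  qed
  then show ?case using b by simp
next
  case (sym n n')
  then show ?case by metis
qed

lemma matched_unique_bud: "inj (walk M) \<Longrightarrow> matched M b l \<Longrightarrow> matched M b' l \<Longrightarrow> b = b'"
  using arch_same_end unfolding matched_def by metis

text \<open>The loop invariant of the matching process. Requiring the whole arch to avoid
  \<open>U\<close>, and not only its two ends, is what prevents removed arches from crossing a
  half-edge that is still present.\<close>

definition arches_removed :: "cmap \<Rightarrow> nat set \<Rightarrow> bool" where
  "arches_removed M U \<longleftrightarrow> U \<subseteq> half_edges M \<and>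
     (\<forall>b \<in> buds M - U. \<exists>n. arch M b n \<and> (\<forall>j\<le>n. (walk M ^^ j) b \<notin> U)) \<and>
     (\<forall>l \<in> leaves M - U. \<exists>b n. arch M b n \<and> l = (walk M ^^ n) b \<and> (\<forall>j\<le>n. (walk M ^^ j) b \<notin> U))"

text \<open>Whatever lies strictly between \<open>b\<close> and \<open>l\<close> was removed along
  arches. None of these can reach over \<open>b\<close> or \<open>l\<close>, which are still in
  \<open>U\<close>, so they nest in the gap and contribute zero.\<close>

lemma arch_followed_by:
  assumes inj: "inj (walk M)" and rem: "arches_removed M U"
    and b: "b \<in> U \<inter> buds M" and l: "l \<in> U \<inter> leaves M"
    and n: "0 < n" "(walk M ^^ n) b = l" and gap: "\<And>j. 0 < j \<Longrightarrow> j < n \<Longrightarrow> (walk M ^^ j) b \<notin> U"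
  shows "arch M b n"
proof -
  let ?x = "\<lambda>j. (walk M ^^ j) b"
  have add: "(walk M ^^ j) (?x i) = ?x (j + i)" for i j by (simp add: funpow_add)
  \<comment> \<open>Only a leaf at the last position could spoil positivity. Such a leaf closes a
    removed arch that starts after \<open>b\<close>; dropping this arch gives a shorter nonempty
    prefix of the same height.\<close>
  have pos: "height M b p > 0" if "0 < p" "p \<le> n" for p
    using that
  proof (induction p rule: less_induct)
    case (less p)
    show ?case
    proof (cases "p = 1")
      case True
      then show ?thesis using b weight_simps(1) by (simp add: height_def)
    next
      case False
      define q where "q = p - 1"
      have q: "p = Suc q" "0 < q" "q < n" using False less.prems by (auto simp: q_def)
      show ?thesis
      proof (cases "?x q \<in> leaves M")
        case False
        then have "weight M (?x q) \<ge> 0" by (simp add: weight_def)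
        moreover have "height M b q > 0" using less.IH[of q] q by simp
        ultimately show ?thesis by (simp add: q height_Suc)
      next
        case True
        then obtain b' k where b': "arch M b' k" "?x q = (walk M ^^ k) b'"
          and out: "\<And>j. j \<le> k \<Longrightarrow> (walk M ^^ j) b' \<notin> U"
          using rem gap[OF q(2,3)] unfolding arches_removed_def by blast
        have "k < q"
        proof (rule ccontr)
          assume "\<not> k < q"
          then have "b = (walk M ^^ (k - q)) b'" using funpow_inj_cancel[OF inj] b' by simp
          then show False using out[of "k - q"] b by simp
        qed
        then have b'q: "b' = ?x (q - k)" using funpow_inj_cancel[OF inj _ b'(2)[symmetric]] by simp
        have "height M b p = height M b (q - k) + height M b' (Suc k)"
          using height_add[of M b "q - k" "Suc k"] b'q \<open>k < q\<close> q by simp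
        then show ?thesis using less.IH[of "q - k"] \<open>k < q\<close> q b'(1) by (simp add: arch_def)
      qed
    qed
  qed
  \<comment> \<open>The mirror image: a bud at the first position opens a removed arch that ends
    before \<open>l\<close>, and this arch can be skipped.\<close>
  have neg: "height M (?x p) (n - p) \<le> 0" if "0 < p" "p \<le> n" for p
    using that
  proof (induction "n - p" arbitrary: p rule: less_induct)
    case less
    show ?case
    proof (cases "p = n")
      case True
      then show ?thesis by (simp add: height_def)
    next
      case False
      then have p: "p < n" using less.prems by simp
      show ?thesis
      proof (cases "?x p \<in> buds M")
        case False
        then have "weight M (?x p) \<le> 0" by (simp add: weight_def)
        moreover have "height M (?x p) (n - p) = weight M (?x p) + height M (?x (Suc p)) (n - Suc p)"
          using height_Suc_left[of M "?x p" "n - Suc p"] p by (simp add: Suc_diff_Suc)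
        moreover have "height M (?x (Suc p)) (n - Suc p) \<le> 0" using less.hyps[of "Suc p"] p by simp
        ultimately show ?thesis by simp
      next
        case True
        then obtain k where k: "arch M (?x p) k"
          and out: "\<And>j. j \<le> k \<Longrightarrow> (walk M ^^ j) (?x p) \<notin> U"
          using rem gap[OF less.prems(1) p] unfolding arches_removed_def by blast
        have "p + k < n"
        proof (rule ccontr)
          assume "\<not> p + k < n"
          then have "?x n \<notin> U" using out[of "n - p"] p by (simp add: add)
          then show False using n l by simp
        qed
        then have "n - p = Suc k + (n - (p + Suc k))" by simp
        then have "height M (?x p) (n - p) = height M (?x p) (Suc k) + height M (?x (p + Suc k)) (n - (p + Suc k))"
          using height_add[of M "?x p" "Suc k" "n - (p + Suc k)"] by (metis add add.commute)
        then show ?thesis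
          using less.hyps[of "p + Suc k"] \<open>p + k < n\<close> k by (simp add: arch_def)
      qed
    qed
  qed
  have "height M b n = 1 + height M (?x 1) (n - 1)"
    using height_Suc_left[of M b "n - 1"] n b weight_simps(1)[of b M] by simp
  \<comment> \<open>Positivity gives at least 1; the bud \<open>b\<close> followed by a remainder of
    height at most 0 gives at most 1. The leaf \<open>l\<close> then brings the height back to zero
    for the first time.\<close>
  then have "height M b n = 1" using pos[of n] neg[of 1] n by simp
  then have "height M b (Suc n) = 0" using n l weight_simps(2)[of l M] by (simp add: height_Suc)
  then show ?thesis using pos b by (simp add: arch_def)
qed

text \<open>A matching step spans an arch whose interior was already free of \<open>U\<close>, and
  the step removes both ends, so the new arch avoids the smaller set entirely.\<close>

lemma unmatched_arches_removed:
  assumes inj: "inj (walk M)" and "unmatched M U"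
  shows "arches_removed M U"
  using assms(2)
proof induction
  case start
  show ?case by (auto simp: arches_removed_def half_edges_split)
next
  case (match U b l)
  obtain n where n: "0 < n" "(walk M ^^ n) b = l"
    and gap: "\<And>j. 0 < j \<Longrightarrow> j < n \<Longrightarrow> (walk M ^^ j) b \<notin> U"
    using match.hyps unfolding followed_by_def by blast
  have arch: "arch M b n" using arch_followed_by[OF inj match.IH match.hyps(2,3) n gap] by blast
  have out: "(walk M ^^ j) b \<notin> U - {b, l}" if "j \<le> n" for j
    using gap[of j] that n by (cases "j = 0"; cases "j = n") auto
  have bud: "x \<in> buds M - (U - {b, l}) \<Longrightarrow> x = b \<or> x \<in> buds M - U" for x
    using match.hyps(3) half_edges_split(2) by blast
  have leaf: "x \<in> leaves M - (U - {b, l}) \<Longrightarrow> x = l \<or> x \<in> leaves M - U" for x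
    using match.hyps(2) half_edges_split(2) by blast
  show ?case
    unfolding arches_removed_def
  proof (intro conjI ballI)
    show "U - {b, l} \<subseteq> half_edges M" using match.IH by (auto simp: arches_removed_def)
  next
    fix x assume "x \<in> buds M - (U - {b, l})"
    then consider "x = b" | "x \<in> buds M - U" using bud by blast
    then show "\<exists>n. arch M x n \<and> (\<forall>j\<le>n. (walk M ^^ j) x \<notin> U - {b, l})"
      using arch out match.IH unfolding arches_removed_def by cases blast+
  next
    fix x assume "x \<in> leaves M - (U - {b, l})"
    then consider "x = l" | "x \<in> leaves M - U" using leaf by blast
    then show "\<exists>b' n. arch M b' n \<and> x = (walk M ^^ n) b' \<and> (\<forall>j\<le>n. (walk M ^^ j) b' \<notin> U - {b, l})"
      using arch out n match.IH unfolding arches_removed_def by cases blast+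
  qed
qed

lemma unmatched_charge:
  assumes "finite (half_edges M)" "unmatched M U"
  shows "int (card (leaves M \<inter> U)) - int (card (buds M \<inter> U)) = total_charge M"
  using assms(2)
proof induction
  case start
  have "leaves M \<inter> half_edges M = leaves M" "buds M \<inter> half_edges M = buds M"
    by (auto simp: half_edges_split)
  then show ?case by (simp add: total_charge_def)
next
  case (match U b l)
  have "leaves M \<inter> U = insert l (leaves M \<inter> (U - {b, l}))" "buds M \<inter> U = insert b (buds M \<inter> (U - {b, l}))"
    using match.hyps half_edges_split(2)[of M] by auto
  moreover have "finite (leaves M)" "finite (buds M)" using assms(1) by (auto simp: half_edges_split)
  ultimately have "card (leaves M \<inter> U) = Suc (card (leaves M \<inter> (U - {b, l})))"
    "card (buds M \<inter> U) = Suc (card (buds M \<inter> (U - {b, l})))"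
    by (metis DiffE IntE card_insert_disjoint finite_Int insertCI)+
  then show ?case using match.IH by simp
qed

section \<open>Maximal runs of the matching process\<close>

definition terminal :: "cmap \<Rightarrow> nat set \<Rightarrow> bool" where
  "terminal M U \<longleftrightarrow> unmatched M U \<and>
     \<not> (\<exists>b \<in> U \<inter> buds M. \<exists>l \<in> U \<inter> leaves M. followed_by M U b l)"

lemma terminal_exists:
  assumes "finite (half_edges M)"
  shows "\<exists>U. terminal M U"
proof -
  have "\<exists>V. terminal M V" if "finite U" "unmatched M U" for U
    using that
  proof (induction U rule: finite_psubset_induct)
    case (psubset U)
    show ?case
    proof (cases "terminal M U")
      case False
      then obtain b l where bl: "b \<in> U \<inter> buds M" "l \<in> U \<inter> leaves M" "followed_by M U b l"
        using psubset.prems by (auto simp: terminal_def)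
      then have "unmatched M (U - {b, l})" using psubset.prems by (blast intro: unmatched.match)
      moreover have "U - {b, l} \<subset> U" using bl by blast
      ultimately show ?thesis using psubset.IH by blast
    qed blast
  qed
  then show ?thesis using assms unmatched.start by blast
qed

lemma walk_permutes: "rooted_map M \<Longrightarrow> walk M permutes darts M"
  using permutes_compose[of "opp M" "darts M" "rot M"]
  by (simp add: rooted_map_def walk_def[abs_def] comp_def)

text \<open>Each step removes one leaf and one bud, so positive total charge leaves a leaf over. All
  half-edges lie on one face, hence the walk from a surviving bud reaches a surviving leaf, and
  somewhere on the way a further match is possible.\<close>

lemma terminal_no_buds:
  assumes M: "rooted_map M" and k: "total_charge M \<ge> 1" and U: "terminal M U"
  shows "U \<inter> buds M = {}"
proof (rule ccontr)
  assume "U \<inter> buds M \<noteq> {}"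
  then obtain b where b: "b \<in> U" "b \<in> buds M" by blast
  have fin: "finite (darts M)" using M by (simp add: rooted_map_def)
  then have finh: "finite (half_edges M)" by (simp add: half_edges_def)
  have inj: "inj (walk M)" using walk_permutes[OF M] by (rule permutes_inj)
  have UM: "unmatched M U" using U by (simp add: terminal_def)
  have Uh: "U \<subseteq> half_edges M" using unmatched_arches_removed[OF inj UM] by (simp add: arches_removed_def)
  have "card (leaves M \<inter> U) > 0" using unmatched_charge[OF finh UM] k by linarith
  then obtain l where l: "l \<in> leaves M \<inter> U" by (metis card_gt_0_iff ex_in_conv)
  have "half_edges M \<subseteq> orbit (walk M) (root_dart M)" using M by (simp add: rooted_map_def)
  then have "b \<in> orbit (walk M) (root_dart M)" "l \<in> orbit (walk M) (root_dart M)"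
    using b l Uh by auto
  then have "l \<in> orbit (walk M) b"
    using walk_permutes[OF M] fin cyclic_on_orbit orbit_cyclic_eq3 by metis
  then have ex: "\<exists>n. 0 < n \<and> (walk M ^^ n) b \<in> leaves M \<inter> U" using l by (auto simp: orbit_altdef)
  define n where "n = (LEAST n. 0 < n \<and> (walk M ^^ n) b \<in> leaves M \<inter> U)"
  have n: "0 < n" "(walk M ^^ n) b \<in> leaves M \<inter> U" using LeastI_ex[OF ex] unfolding n_def by blast+
  have nmin: "(walk M ^^ j) b \<notin> leaves M \<inter> U" if "0 < j" "j < n" for j
    using not_less_Least[of j "\<lambda>n. 0 < n \<and> (walk M ^^ n) b \<in> leaves M \<inter> U"] that
    unfolding n_def by blast
  \<comment> \<open>Position \<open>n\<close> carries the first surviving leaf after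
    \<open>b\<close>. The last position of \<open>J\<close> carries a surviving half-edge that is
    not a leaf, hence a bud, and nothing of \<open>U\<close> separates it from that leaf.\<close>
  define J where "J = {j. j < n \<and> (walk M ^^ j) b \<in> U}"
  have J: "finite J" "0 \<in> J" using n b by (auto simp: J_def)
  define m where "m = Max J"
  have mJ: "m \<in> J" using Max_in J by (auto simp: m_def)
  have mmax: "j \<le> m" if "j \<in> J" for j using Max_ge J that by (auto simp: m_def)
  let ?c = "(walk M ^^ m) b"
  have c: "?c \<in> U \<inter> buds M"
  proof (cases "m = 0")
    case True
    then show ?thesis using b by simp
  next
    case False
    then show ?thesis using mJ nmin[of m] Uh by (auto simp: J_def half_edges_split)
  qed
  have step: "(walk M ^^ j) ?c = (walk M ^^ (j + m)) b" for j by (simp add: funpow_add)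
  have "followed_by M U ?c ((walk M ^^ n) b)"
    unfolding followed_by_def
  proof (intro conjI exI[of _ "n - m"] allI impI)
    show "(walk M ^^ n) b \<in> U" using n by simp
    show "0 < n - m" using mJ by (auto simp: J_def)
    then show "(walk M ^^ (n - m)) ?c = (walk M ^^ n) b" by (simp add: step)
  next
    fix j assume j: "0 < j \<and> j < n - m"
    then have "j + m \<notin> J" using mmax[of "j + m"] by auto
    then show "(walk M ^^ j) ?c \<notin> U" using j by (auto simp: step J_def less_diff_conv)
  qed
  then show False using U c n unfolding terminal_def by blast
qed

lemma bud_matched:
  assumes M: "rooted_map M" and k: "total_charge M \<ge> 1" and b: "b \<in> buds M"
  shows "\<exists>l. matched M b l"
proof -
  have "finite (half_edges M)" using M by (simp add: rooted_map_def half_edges_def)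
  then obtain U where U: "terminal M U" using terminal_exists by blast
  have inj: "inj (walk M)" using walk_permutes[OF M] by (rule permutes_inj)
  have "arches_removed M U" using unmatched_arches_removed[OF inj] U by (simp add: terminal_def)
  moreover have "b \<notin> U" using terminal_no_buds[OF M k U] b by blast
  ultimately show ?thesis using b unfolding arches_removed_def matched_def by blast
qed

text \<open>This is the independence of the order: \<open>single\<close> asks for some maximal run,
  but every maximal run keeps exactly the leaves that end no arch. A bud never survives, so the arch
  of a matched leaf has been removed as a whole.\<close>

lemma single_iff_not_matched:
  assumes M: "rooted_map M" and k: "total_charge M \<ge> 1"
  shows "single M l \<longleftrightarrow> l \<in> leaves M \<and> (\<nexists>b. matched M b l)"
proof -
  have inj: "inj (walk M)" using walk_permutes[OF M] by (rule permutes_inj)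
  have finh: "finite (half_edges M)" using M by (simp add: rooted_map_def half_edges_def)
  have single: "single M l \<longleftrightarrow> l \<in> leaves M \<and> (\<exists>U. terminal M U \<and> l \<in> U)"
    by (auto simp: single_def terminal_def)
  have rem: "arches_removed M U" if "terminal M U" for U
    using unmatched_arches_removed[OF inj] that by (simp add: terminal_def)
  have "\<nexists>b. matched M b l" if U: "terminal M U" "l \<in> U" for U
  proof
    assume "\<exists>b. matched M b l"
    then obtain b n where bn: "arch M b n" "l = (walk M ^^ n) b" by (auto simp: matched_def)
    then have "b \<in> buds M - U" using terminal_no_buds[OF M k U(1)] by (auto simp: arch_def)
    then obtain n' where "arch M b n'" "\<forall>j\<le>n'. (walk M ^^ j) b \<notin> U"
      using rem[OF U(1)] unfolding arches_removed_def by blast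
    then show False using bn arch_unique U(2) by blast
  qed
  moreover have "l \<in> U" if "terminal M U" "\<nexists>b. matched M b l" "l \<in> leaves M" for U
    using rem[OF that(1)] that(2,3) unfolding arches_removed_def matched_def by blast
  ultimately show ?thesis using single terminal_exists[OF finh] by blast
qed

section \<open>Cutting an edge\<close>

lemma orbit_eq_iff:
  assumes "f permutes S" "finite S"
  shows "y \<in> orbit f x \<longleftrightarrow> orbit f y = orbit f x"
proof -
  have "permutation f" using assms by (auto simp: permutation_permutes)
  then show ?thesis
    using cyclic_on_orbit'[of f x] orbit_cyclic_eq3 permutation_self_in_orbit by metis
qed

lemma component_refl: "d \<in> component M d"
  by (simp add: component_def)

lemma component_closed:
  assumes "x \<in> component M d"
  shows "rot M x \<in> component M d" "opp M x \<in> component M d"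
  using assms unfolding component_def by (auto intro: rtrancl_into_rtrancl)

lemma component_least:
  assumes "x \<in> component M d" "d \<in> S" "\<And>y. y \<in> S \<Longrightarrow> rot M y \<in> S" "\<And>y. y \<in> S \<Longrightarrow> opp M y \<in> S"
  shows "x \<in> S"
proof -
  have "(d, x) \<in> {(x, y). y = rot M x \<or> y = opp M x}\<^sup>*" using assms(1) by (simp add: component_def)
  then show ?thesis using assms(2-) by induction auto
qed

lemma component_trans: "x \<in> component M d \<Longrightarrow> y \<in> component M x \<Longrightarrow> y \<in> component M d"
  by (auto simp: component_def)

text \<open>\<open>component\<close> follows \<open>rot\<close> and \<open>opp\<close> forwards
  only. Steps can be undone because \<open>opp\<close> is an involution and, on a finite set, one
  gets back from \<open>rot M y\<close> to \<open>y\<close> by iterating \<open>rot\<close>.\<close>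

lemma component_sym:
  assumes "finite D" "rot M permutes D" "\<And>d. opp M (opp M d) = d" "x \<in> component M d"
  shows "d \<in> component M x"
proof -
  have step_back: "y \<in> component M (rot M y)" "y \<in> component M (opp M y)" for y
  proof -
    have "y \<in> orbit (rot M) (rot M y)"
      using assms(1,2) orbit_eq_iff[OF assms(2,1)] orbit.base by metis
    moreover have "z \<in> component M (rot M y)" if "z \<in> orbit (rot M) (rot M y)" for z
      using that by induction (auto intro: component_closed component_refl)
    ultimately show "y \<in> component M (rot M y)" by blast
    show "y \<in> component M (opp M y)"
      using component_closed(2)[OF component_refl[of "opp M y" M]] assms(3) by simp
  qed
  show ?thesis
    by (rule component_least[OF assms(4), of "{z. d \<in> component M z}", simplified])
       (auto intro: component_refl component_trans step_back)
qed

text \<open>A connected graph contains a spanning tree. It is needed for the map with one edge cut,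
  to show that this map is no longer connected.\<close>

lemma vertices_le_edges:
  assumes fin: "finite (darts M)" and rot: "rot M permutes darts M" and opp: "opp M permutes darts M"
    and conn: "component M d = darts M"
  shows "card (vertices M) \<le> card (edges M) + 1"
proof -
  have d: "d \<in> darts M" using conn component_refl by blast
  have finV: "finite (vertices M)" using fin by (simp add: vertices_def)
  have finE: "finite (edges M)"
  proof -
    have "edges M \<subseteq> (\<lambda>d. {d, opp M d}) ` darts M" by (auto simp: edges_def)
    then show ?thesis using fin finite_surj by blast
  qed
  note eq_iff = orbit_eq_iff[OF rot fin]
  have vert: "orbit (rot M) x \<in> A" if "A \<subseteq> vertices M" "x \<in> \<Union>A" for x A
    using that eq_iff unfolding vertices_def by fastforce
  \<comment> \<open>A subtree grown from the vertex of \<open>d\<close>, with vertices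
    \<open>A\<close> and edges \<open>F\<close>. As long as a vertex is missing, connectedness gives
    an edge leaving \<open>A\<close>; it is new because the edges in \<open>F\<close> have both ends
    in \<open>A\<close>.\<close>
  have subtree: "\<exists>A F. A \<subseteq> vertices M \<and> F \<subseteq> edges M \<and> card A = Suc k \<and> card F = k \<and> d \<in> \<Union>A \<and> \<Union>F \<subseteq> \<Union>A"
    if "Suc k \<le> card (vertices M)" for k
    using that
  proof (induction k)
    case 0
    have "{orbit (rot M) d} \<subseteq> vertices M" "d \<in> orbit (rot M) d" using d eq_iff by (auto simp: vertices_def)
    then show ?case by (intro exI[of _ "{orbit (rot M) d}"] exI[of _ "{}"]) simp
  next
    case (Suc k)
    then obtain A F where AF: "A \<subseteq> vertices M" "F \<subseteq> edges M" "card A = Suc k" "card F = k" "d \<in> \<Union>A" "\<Union>F \<subseteq> \<Union>A"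
      by auto
    have "A \<noteq> vertices M" using AF(3) Suc.prems by auto
    then obtain x where x: "x \<in> darts M" "orbit (rot M) x \<notin> A" using AF(1) unfolding vertices_def by blast
    then have "x \<notin> \<Union>A" using vert[OF AF(1)] by blast
    have "\<exists>y \<in> \<Union>A. opp M y \<notin> \<Union>A"
    proof (rule ccontr)
      assume no: "\<not> ?thesis"
      have "rot M y \<in> \<Union>A" if "y \<in> \<Union>A" for y
        using UnionI[OF vert[OF AF(1) that] orbit.base] .
      then have "x \<in> \<Union>A" using component_least[of x M d "\<Union>A"] x conn AF(5) no by blast
      with \<open>x \<notin> \<Union>A\<close> show False ..
    qed
    then obtain y where y: "y \<in> \<Union>A" "opp M y \<notin> \<Union>A" by blast
    have "\<Union>A \<subseteq> darts M" using AF(1) permutes_orbit_subset[OF rot] by (fastforce simp: vertices_def)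
    then have yD: "y \<in> darts M" using y(1) by blast
    then have zD: "opp M y \<in> darts M" using opp by (simp add: permutes_in_image)
    let ?v = "orbit (rot M) (opp M y)"
    have zv: "opp M y \<in> ?v" using eq_iff by simp
    have "?v \<notin> A" using y(2) zv by blast
    moreover have "{y, opp M y} \<notin> F" using AF(6) y(2) by blast
    moreover have "finite A" "finite F" using AF(1,2) finV finE by (simp_all add: finite_subset)
    ultimately have "card (insert ?v A) = Suc (Suc k)" "card (insert {y, opp M y} F) = Suc k"
      using AF(3,4) by simp_all
    moreover have "{y, opp M y} \<in> edges M"
    proof -
      have "opp M y \<noteq> y" using y by metis
      then show ?thesis using yD unfolding edges_def by blast
    qed
    then have "insert {y, opp M y} F \<subseteq> edges M" using AF(2) by simp
    moreover have "insert ?v A \<subseteq> vertices M" using zD AF(1) by (simp add: vertices_def)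
    moreover have "d \<in> \<Union>(insert ?v A)" using AF(5) by simp
    moreover have "\<Union>(insert {y, opp M y} F) \<subseteq> \<Union>(insert ?v A)"
    proof -
      have "\<Union>A \<subseteq> \<Union>(insert ?v A)" "?v \<subseteq> \<Union>(insert ?v A)" by (simp_all add: Union_mono subset_insertI)
      then have "\<Union>F \<subseteq> \<Union>(insert ?v A)" "y \<in> \<Union>(insert ?v A)" "opp M y \<in> \<Union>(insert ?v A)"
        using AF(6) y(1) zv by (auto simp only:)
      then show ?thesis by (simp only: Union_insert Un_subset_iff insert_subset empty_subsetI simp_thms)
    qed
    ultimately show ?case by blast
  qed
  show ?thesis
  proof (cases "card (vertices M)")
    case (Suc k)
    then obtain F where "F \<subseteq> edges M" "card F = k" using subtree[of k] by auto
    then show ?thesis using Suc card_mono[OF finE] by fastforce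
  qed simp
qed

lemma cut_simps [simp]:
  "darts (cut M d) = darts M" "rot (cut M d) = rot M" "vertices (cut M d) = vertices M"
  "opp (cut M d) = (opp M)(d := d, opp M d := opp M d)"
  by (simp_all add: cut_def vertices_def)

lemma cut_opp: "opp M (opp M d) = d \<Longrightarrow> cut M (opp M d) = cut M d"
  by (cases "opp M d = d") (simp_all add: cut_def fun_upd_twist)

context
  fixes M :: cmap and d :: nat
  assumes T: "tree M" and d: "d \<in> darts M" "opp M d \<noteq> d"
begin

private lemma fin: "finite (darts M)" and rot: "rot M permutes darts M"
  and opp: "opp M permutes darts M" and opp_opp: "opp M (opp M x) = x"
  and conn: "x \<in> darts M \<Longrightarrow> component M x = darts M"
  using T by (auto simp: tree_def rooted_map_def)

private lemma cut_opp_opp: "opp (cut M d) (opp (cut M d) x) = x"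
  using opp_opp by (auto simp: fun_upd_def) metis+

private lemma cut_opp_permutes: "opp (cut M d) permutes darts M"
proof -
  have "opp (cut M d) x = x" if "x \<notin> darts M" for x
    using that opp by (auto simp: permutes_def)
  then show ?thesis using cut_opp_opp unfolding permutes_def by metis
qed

private lemma component_cut_subset: "x \<in> darts M \<Longrightarrow> component (cut M d) x \<subseteq> darts M"
  using component_least[of _ "cut M d" x "darts M"] rot cut_opp_permutes
  by (metis cut_simps(2) permutes_in_image subsetI)

private lemma oppd: "opp M d \<in> darts M"
  using d opp by (simp add: permutes_in_image)

text \<open>A path of \<open>M\<close> starting at \<open>d\<close> is broken by the cut only where
  it crosses the edge of \<open>d\<close>, and there it lands on one of the two base points.\<close>

private lemma component_cut_cover:
  "component (cut M d) d \<union> component (cut M d) (opp M d) = darts M"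
proof
  show "component (cut M d) d \<union> component (cut M d) (opp M d) \<subseteq> darts M"
    using component_cut_subset d oppd by blast
  let ?S = "component (cut M d) d \<union> component (cut M d) (opp M d)"
  show "darts M \<subseteq> ?S"
  proof
    fix x assume "x \<in> darts M"
    then have "x \<in> component M d" using conn d by simp
    then show "x \<in> ?S"
    proof (rule component_least)
      show "d \<in> ?S" by (simp add: component_refl)
      show "rot M y \<in> ?S" if "y \<in> ?S" for y
        using that component_closed(1)[of y "cut M d"] by auto
      show "opp M y \<in> ?S" if "y \<in> ?S" for y
      proof (cases "y = d \<or> y = opp M d")
        case True
        then show ?thesis using component_refl opp_opp by auto
      next
        case False
        then have "opp (cut M d) y = opp M y" by simp
        then show ?thesis using that component_closed(2)[of y "cut M d"] by (metis Un_iff)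
      qed
    qed
  qed
qed

private lemma edges_cut: "card (edges M) = Suc (card (edges (cut M d)))"
proof -
  have "edges M = insert {d, opp M d} (edges (cut M d))"
  proof (intro equalityI subsetI)
    fix e assume "e \<in> edges M"
    then obtain x where x: "e = {x, opp M x}" "x \<in> darts M" "opp M x \<noteq> x" by (auto simp: edges_def)
    show "e \<in> insert {d, opp M d} (edges (cut M d))"
    proof (cases "x = d \<or> x = opp M d")
      case True
      then show ?thesis using x opp_opp by auto
    next
      case False
      then show ?thesis using x unfolding edges_def by (auto intro!: exI[of _ x])
    qed
  next
    fix e assume "e \<in> insert {d, opp M d} (edges (cut M d))"
    then show "e \<in> edges M" using d unfolding edges_def by (auto split: if_splits)
  qed
  moreover have "{d, opp M d} \<notin> edges (cut M d)"
  proof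
    assume "{d, opp M d} \<in> edges (cut M d)"
    then obtain x where "{d, opp M d} = {x, opp (cut M d) x}" "opp (cut M d) x \<noteq> x"
      unfolding edges_def by blast
    then show False by (auto simp: doubleton_eq_iff split: if_splits)
  qed
  moreover have "finite (edges (cut M d))"
  proof -
    have "edges (cut M d) \<subseteq> (\<lambda>x. {x, opp (cut M d) x}) ` darts M" by (auto simp: edges_def)
    then show ?thesis using fin finite_surj by blast
  qed
  ultimately show ?thesis by simp
qed

text \<open>By Euler's relation a tree has one more vertex than edges, so that it cannot lose an edge
  and stay connected.\<close>

private lemma component_cut_disjoint:
  "component (cut M d) d \<inter> component (cut M d) (opp M d) = {}"
proof (rule ccontr)
  assume "\<not> ?thesis"
  then obtain x where x: "x \<in> component (cut M d) d" "x \<in> component (cut M d) (opp M d)" by blast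
  have "opp M d \<in> component (cut M d) x"
    by (rule component_sym[of "darts M"]) (use x fin rot cut_opp_opp in simp_all)
  then have "opp M d \<in> component (cut M d) d" using x(1) component_trans by metis
  then have "component (cut M d) d = darts M"
    using component_cut_cover component_trans by blast
  then have "card (vertices M) \<le> card (edges (cut M d)) + 1"
    using vertices_le_edges[of "cut M d" d] fin rot cut_opp_permutes by simp
  moreover have "card (vertices M) + 1 = card (edges M) + 2"
    using T by (simp add: tree_def rooted_map_def)
  ultimately show False using edges_cut by simp
qed

lemma darts_side: "darts (side M d) = component (cut M d) d"
  by (simp add: side_def Let_def)

private lemma darts_side_opp: "darts (side M (opp M d)) = component (cut M d) (opp M d)"
  by (simp add: side_def Let_def cut_opp opp_opp)

lemma side_cover: "darts (side M d) \<union> darts (side M (opp M d)) = darts M"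
  and side_disjoint: "darts (side M d) \<inter> darts (side M (opp M d)) = {}"
  using component_cut_cover component_cut_disjoint by (simp_all add: darts_side darts_side_opp)

private lemma opp_notin: "opp M d \<notin> darts (side M d)"
  using side_disjoint component_refl darts_side_opp by blast

text \<open>The one half-edge that the cut adds to this side is \<open>d\<close>, which is its root
  and therefore not counted; its counterpart \<open>opp M d\<close> lies on the other side.\<close>

lemma charge_side:
  "charge (side M d) = int (card (leaves M \<inter> darts (side M d))) - int (card (buds M \<inter> darts (side M d)))"
proof -
  let ?D = "darts (side M d)"
  have root: "root_dart (side M d) = d" by (simp add: side_def Let_def)
  have "half_edges (side M d) - {d} = half_edges M \<inter> ?D"
  proof -
    have "opp (side M d) x = opp M x" if "x \<in> ?D" "x \<noteq> d" for x
      using that opp_notin by (auto simp: side_def Let_def perm_restrict_def)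
    moreover have "?D \<subseteq> darts M" using side_cover by blast
    ultimately have "x \<in> half_edges (side M d) - {d} \<longleftrightarrow> x \<in> half_edges M \<inter> ?D" for x
      using d by (cases "x = d") (auto simp: half_edges_def)
    then show ?thesis by blast
  qed
  then have "leaves (side M d) - {d} = leaves M \<inter> ?D" "buds (side M d) - {d} = buds M \<inter> ?D"
    by (auto simp: leaves_def buds_def side_def Let_def)
  then show ?thesis by (simp add: charge_def root)
qed

text \<open>Count the darts of the side by colour. Both numbers are sums of vertex degrees, hence
  multiples of \<open>m\<close>. In their difference the inner edges cancel, leaving the charge and
  the dart \<open>d\<close> itself, which gives the summand 1 or -1.\<close>

lemma charge_side_cong:
  assumes m: "degrees_multiples_of m M"
  shows "int m dvd charge (side M d) + (if white M d then 1 else - 1)"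
proof -
  let ?D = "darts (side M d)"
  have D: "?D \<subseteq> darts M" using side_cover by blast
  then have finD: "finite ?D" using fin finite_subset by blast
  have white_rot: "white M (rot M x) = white M x" if "x \<in> darts M" for x
    using T that by (simp add: tree_def rooted_map_def)
  have white_orbit: "white M y = white M x" if "y \<in> orbit (rot M) x" "x \<in> darts M" for x y
  proof -
    have "y \<in> darts M \<and> white M y = white M x"
      using that by induction (simp_all add: white_rot permutes_in_image[OF rot])
    then show ?thesis ..
  qed
  have m_dvd: "m dvd card {x \<in> ?D. white M x = c}" (is "m dvd card ?S") for c
  proof -
    \<comment> \<open>The darts of one colour form whole vertices: a side is closed under
      \<open>rot\<close>, and colour is constant around a vertex.\<close>
    have S: "\<Union> (orbit (rot M) ` ?S) = ?S"
    proof (intro equalityI subsetI)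
      fix y assume "y \<in> \<Union> (orbit (rot M) ` ?S)"
      then obtain x where x: "x \<in> ?S" "y \<in> orbit (rot M) x" by blast
      then have "white M y = c" using white_orbit D by blast
      moreover have "y \<in> ?D" using x(2)
        by induction (use x(1) component_closed(1)[of _ "cut M d"] darts_side in auto)
      ultimately show "y \<in> ?S" by simp
    next
      fix y assume "y \<in> ?S"
      then show "y \<in> \<Union> (orbit (rot M) ` ?S)" using orbit_eq_iff[OF rot fin] by blast
    qed
    have "m dvd card (\<Union> (orbit (rot M) ` ?S))"
    proof (rule dvd_partition)
      show "finite (\<Union> (orbit (rot M) ` ?S))" using S finD by simp
      show "\<forall>v\<in>orbit (rot M) ` ?S. m dvd card v"
        using m D by (auto simp: degrees_multiples_of_def vertices_def)
      show "\<forall>v\<in>orbit (rot M) ` ?S. \<forall>w\<in>orbit (rot M) ` ?S. v \<noteq> w \<longrightarrow> v \<inter> w = {}"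
        using orbit_eq_iff[OF rot fin] by blast
    qed
    then show ?thesis by (simp only: S)
  qed
  \<comment> \<open>The ends of colour \<open>c\<close> of the uncut edges of the side;
    \<open>opp M\<close> pairs the white ends with the black ones.\<close>
  let ?I = "\<lambda>c. {x \<in> ?D - {d}. opp M x \<noteq> x \<and> white M x = c}"
  have "bij_betw (opp M) (?I True) (?I False)"
  proof (rule bij_betw_byWitness[of _ "opp M"])
    have "opp M x \<in> ?D - {d} \<and> white M (opp M x) \<noteq> white M x" if "x \<in> ?D - {d}" "opp M x \<noteq> x" for x
    proof -
      have "x \<noteq> opp M d" using that opp_notin by blast
      then have "opp M x \<in> ?D" using that component_closed(2)[of x "cut M d" d] by (simp add: darts_side)
      moreover have "opp M x \<noteq> d" using \<open>x \<noteq> opp M d\<close> opp_opp by auto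
      moreover have "white M (opp M x) \<noteq> white M x" using T that D by (auto simp: tree_def rooted_map_def)
      ultimately show ?thesis by simp
    qed
    then show "opp M ` ?I True \<subseteq> ?I False" "opp M ` ?I False \<subseteq> ?I True"
      using opp_opp by auto
  qed (auto simp: opp_opp)
  then have inner: "card (?I True) = card (?I False)" by (rule bij_betw_same_card)
  have dD: "d \<in> ?D" by (simp add: darts_side component_refl)
  have "{x \<in> ?D. white M x = True} = (leaves M \<inter> ?D) \<union> ?I True \<union> (if white M d then {d} else {})"
    "{x \<in> ?D. white M x = False} = (buds M \<inter> ?D) \<union> ?I False \<union> (if white M d then {} else {d})"
    using D dD d by (auto simp: leaves_def buds_def half_edges_def)
  moreover have "card ((leaves M \<inter> ?D) \<union> ?I True \<union> (if white M d then {d} else {}))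
      = card (leaves M \<inter> ?D) + card (?I True) + (if white M d then 1 else 0)"
    "card ((buds M \<inter> ?D) \<union> ?I False \<union> (if white M d then {} else {d}))
      = card (buds M \<inter> ?D) + card (?I False) + (if white M d then 0 else 1)"
    using d finD by (subst card_Un_disjoint; (subst card_Un_disjoint)?; auto simp: leaves_def buds_def half_edges_def)+
  ultimately have "charge (side M d) + (if white M d then 1 else - 1)
      = int (card {x \<in> ?D. white M x = True}) - int (card {x \<in> ?D. white M x = False})"
    using inner by (simp add: charge_side)
  then show ?thesis using m_dvd[of True] m_dvd[of False] by (simp only: dvd_diff of_nat_dvd_iff)
qed

end

text \<open>Each half-edge of \<open>M\<close> falls on exactly one side, and the leaf and the bud
  made by the cut are roots, so neither is counted.\<close>

lemma charge_side_opp: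
  assumes T: "tree M" and d: "d \<in> darts M" "opp M d \<noteq> d"
  shows "charge (side M d) + charge (side M (opp M d)) = total_charge M"
proof -
  have oo: "opp M (opp M d) = d" and D: "opp M d \<in> darts M" and fin: "finite (darts M)"
    using T d by (auto simp: tree_def rooted_map_def permutes_in_image)
  let ?A = "darts (side M d)" and ?B = "darts (side M (opp M d))"
  have split: "card X = card (X \<inter> ?A) + card (X \<inter> ?B)" if "X \<subseteq> darts M" for X
  proof -
    have "X = (X \<inter> ?A) \<union> (X \<inter> ?B)" using that side_cover[OF T d] by blast
    moreover have "(X \<inter> ?A) \<inter> (X \<inter> ?B) = {}" using side_disjoint[OF T d] by blast
    moreover have "finite X" using fin that finite_subset by blast
    ultimately show ?thesis by (metis card_Un_disjoint finite_Int)
  qed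
  have "leaves M \<subseteq> darts M" "buds M \<subseteq> darts M" by (auto simp: leaves_def buds_def half_edges_def)
  then show ?thesis
    using split[of "leaves M"] split[of "buds M"] charge_side[OF T d] charge_side[OF T D] d oo
    by (simp add: total_charge_def)
qed

section \<open>Rerooting\<close>

definition reroot :: "cmap \<Rightarrow> nat \<Rightarrow> cmap" where
  "reroot M r = M\<lparr>root_dart := r\<rparr>"

lemma reroot_simps [simp]:
  "darts (reroot M r) = darts M" "rot (reroot M r) = rot M" "opp (reroot M r) = opp M"
  "white (reroot M r) = white M" "root_dart (reroot M r) = r" "reroot (reroot M r') r = reroot M r"
  "reroot M (root_dart M) = M"
  by (simp_all add: reroot_def)

lemma reroot_invariants [simp]:
  "half_edges (reroot M r) = half_edges M" "leaves (reroot M r) = leaves M" "buds (reroot M r) = buds M"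
  "walk (reroot M r) = walk M" "vertices (reroot M r) = vertices M" "edges (reroot M r) = edges M"
  "faces (reroot M r) = faces M" "component (reroot M r) = component M"
  "total_charge (reroot M r) = total_charge M" "degrees_multiples_of m (reroot M r) = degrees_multiples_of m M"
  "white_degrees (reroot M r) = white_degrees M" "black_degrees (reroot M r) = black_degrees M"
  "side (reroot M r) = side M"
proof -
  show half: "half_edges (reroot M r) = half_edges M"
    by (simp add: half_edges_def)
  show leaf: "leaves (reroot M r) = leaves M" and bud: "buds (reroot M r) = buds M"
    by (simp_all add: leaves_def buds_def half)
  show walk: "walk (reroot M r) = walk M" by (simp add: walk_def fun_eq_iff)
  show vert: "vertices (reroot M r) = vertices M" by (simp add: vertices_def)
  show "edges (reroot M r) = edges M" by (simp add: edges_def)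
  show "faces (reroot M r) = faces M" by (simp add: faces_def walk)
  show comp: "component (reroot M r) = component M" for M r by (simp add: component_def fun_eq_iff)
  show "total_charge (reroot M r) = total_charge M" by (simp add: total_charge_def leaf bud)
  show "degrees_multiples_of m (reroot M r) = degrees_multiples_of m M"
    by (simp add: degrees_multiples_of_def vert)
  show "white_degrees (reroot M r) = white_degrees M" "black_degrees (reroot M r) = black_degrees M"
    by (simp_all add: white_degrees_def black_degrees_def vert)
  have "cut (reroot M r) = (\<lambda>d. reroot (cut M d) r)" by (simp add: cut_def reroot_def fun_eq_iff)
  then show "side (reroot M r) = side M" by (simp add: side_def fun_eq_iff comp)
qed

lemma matched_reroot [simp]: "matched (reroot M r) = matched M"
proof -
  have "height (reroot M r) = height M" by (simp add: height_def weight_def fun_eq_iff)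
  then have "arch (reroot M r) = arch M" by (simp add: arch_def fun_eq_iff)
  then show ?thesis by (simp add: matched_def fun_eq_iff)
qed

text \<open>Apart from being a half-edge, the root only has to mark the face that carries all
  half-edges, and \<open>r\<close> lies on that face already.\<close>

lemma rooted_map_reroot:
  assumes M: "rooted_map M" and r: "r \<in> half_edges M"
  shows "rooted_map (reroot M r)"
proof -
  have "finite (darts M)" and sub: "half_edges M \<subseteq> orbit (walk M) (root_dart M)"
    using M by (simp_all add: rooted_map_def)
  then have "orbit (walk M) r = orbit (walk M) (root_dart M)"
    using orbit_eq_iff[OF walk_permutes[OF M]] r by blast
  then show ?thesis using M r by (simp add: rooted_map_def)
qed

text \<open>Leaving out the root shifts the charge in opposite directions for a leaf and a bud. So
  charge \<open>m - 1\<close> at a leaf and charge \<open>m + 1\<close> at a bud both mean total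
  charge \<open>m\<close>.\<close>

lemma charge_total:
  assumes "finite (darts M)"
  shows "root_dart M \<in> leaves M \<Longrightarrow> charge M = total_charge M - 1"
    and "root_dart M \<in> buds M \<Longrightarrow> charge M = total_charge M + 1"
proof -
  have fin: "finite (leaves M)" "finite (buds M)"
    using assms by (simp_all add: leaves_def buds_def half_edges_def)
  show "charge M = total_charge M - 1" if r: "root_dart M \<in> leaves M"
  proof -
    have "buds M - {root_dart M} = buds M" using r half_edges_split(2)[of M] by blast
    then show ?thesis using card_Suc_Diff1[OF fin(1) r] by (simp add: charge_def total_charge_def)
  qed
  show "charge M = total_charge M + 1" if r: "root_dart M \<in> buds M"
  proof -
    have "leaves M - {root_dart M} = leaves M" using r half_edges_split(2)[of M] by blast
    then show ?thesis using card_Suc_Diff1[OF fin(2) r] by (simp add: charge_def total_charge_def)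
  qed
qed

text \<open>If the root moves to the other side of an edge, the lower subtree is replaced by the opposite
  one. With all degrees divisible by \<open>m\<close>, the charge of a side at its white end is \<open>-1\<close> modulo
  \<open>m\<close>, so that the bound \<open>\<ge> 0\<close> improves to \<open>\<ge> m - 1\<close>; as the two charges add up to \<open>m\<close>, the bounds
  required of the two sides are then equivalent.\<close>

lemma blossom_tree_reroot:
  assumes M: "blossom_tree M" and deg: "degrees_multiples_of m M" and m: "m \<ge> 1"
    and total: "total_charge M = int m" and r: "r \<in> half_edges M"
  shows "blossom_tree (reroot M r)"
proof -
  have T: "tree M" using M by (simp add: blossom_tree_def)
  \<comment> \<open>The bound is shown for both sides of every edge, whichever is the lower one, so
    the position of the new root no longer matters.\<close>
  have "if white M d then charge (side M d) \<ge> 0 else charge (side M d) \<le> 1"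
    if d: "d \<in> darts M" "opp M d \<noteq> d" for d
  proof -
    have bound: "if white M e then charge (side M e) \<ge> 0 else charge (side M e) \<le> 1"
      if "e \<in> darts M" "opp M e \<noteq> e" "root_dart M \<notin> darts (side M e)" for e
      using M that by (auto simp: blossom_tree_def)
    have o: "opp M d \<in> darts M" "opp M (opp M d) = d" "white M (opp M d) \<longleftrightarrow> \<not> white M d"
      using T d by (auto simp: tree_def rooted_map_def permutes_in_image)
    have sum: "charge (side M d) + charge (side M (opp M d)) = int m"
      using charge_side_opp[OF T d] total by simp
    consider "root_dart M \<notin> darts (side M d)" | "root_dart M \<notin> darts (side M (opp M d))"
      using side_disjoint[OF T d] by blast
    then show ?thesis
    proof cases
      case 1
      then show ?thesis using bound d by blast
    next
      case 2
      then have b: "if white M d then charge (side M (opp M d)) \<le> 1 else charge (side M (opp M d)) \<ge> 0"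
        using bound[of "opp M d"] o d by (auto split: if_splits)
      show ?thesis
      proof (cases "white M d")
        case True
        \<comment> \<open>The opposite black side has charge at most 1, so this side has charge at
          least \<open>m - 1\<close>, which is nonnegative.\<close>
        then show ?thesis using b sum m by simp
      next
        case False
        have "int m dvd charge (side M (opp M d)) + 1"
          using charge_side_cong[OF T o(1) _ deg] o d False by simp
        \<comment> \<open>The bound \<open>>= 0\<close> makes the multiple of \<open>m\<close> on
          the right positive, hence at least \<open>m\<close>.\<close>
        then have "int m \<le> charge (side M (opp M d)) + 1"
          using b False by (intro zdvd_imp_le) auto
        then show ?thesis using sum False by simp
      qed
    qed
  qed
  moreover have "tree (reroot M r)" using T rooted_map_reroot r by (simp add: tree_def)
  ultimately show ?thesis by (simp add: blossom_tree_def)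
qed

section \<open>Invariance under isomorphism\<close>

context
  fixes M N :: cmap and h :: "nat \<Rightarrow> nat"
  assumes M: "rooted_map M" and N: "rooted_map N" and h: "is_iso h M N"
begin

private lemma finD: "finite (darts M)" and rotM: "rot M permutes darts M" and oppM: "opp M permutes darts M"
  using M by (auto simp: rooted_map_def)

private lemma bij: "bij_betw h (darts M) (darts N)"
  and rot_iso: "d \<in> darts M \<Longrightarrow> rot N (h d) = h (rot M d)"
  and opp_iso: "d \<in> darts M \<Longrightarrow> opp N (h d) = h (opp M d)"
  and white_iso: "d \<in> darts M \<Longrightarrow> white N (h d) = white M d"
  using h by (auto simp: is_iso_def)

lemma root_iso: "root_dart N = h (root_dart M)"
  using h by (simp add: is_iso_def)

private lemma inj: "inj_on h (darts M)" and image: "h ` darts M = darts N"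
  using bij by (auto simp: bij_betw_def)

private lemma closed:
  assumes "d \<in> darts M"
  shows "rot M d \<in> darts M" "opp M d \<in> darts M" "walk M d \<in> darts M" "(walk M ^^ n) d \<in> darts M"
proof -
  show "rot M d \<in> darts M" "opp M d \<in> darts M" "walk M d \<in> darts M"
    using assms rotM oppM walk_permutes[OF M] by (simp_all add: permutes_in_image)
  show "(walk M ^^ n) d \<in> darts M"
    using assms by (induction n) (simp_all add: permutes_in_image[OF walk_permutes[OF M]])
qed

private lemma half_edges_iso: "d \<in> darts M \<Longrightarrow> h d \<in> half_edges N \<longleftrightarrow> d \<in> half_edges M"
  using image opp_iso closed(2) inj by (auto simp: half_edges_def inj_on_eq_iff)

private lemma leaves_iso: "d \<in> darts M \<Longrightarrow> h d \<in> leaves N \<longleftrightarrow> d \<in> leaves M"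
  and buds_iso: "d \<in> darts M \<Longrightarrow> h d \<in> buds N \<longleftrightarrow> d \<in> buds M"
  by (auto simp: leaves_def buds_def half_edges_iso white_iso)

private lemma half_edges_darts: "leaves M' \<subseteq> darts M'" "buds M' \<subseteq> darts M'"
  by (auto simp: leaves_def buds_def half_edges_def)

lemma total_charge_iso: "total_charge N = total_charge M"
proof -
  have "leaves N = h ` {d \<in> darts M. h d \<in> leaves N}" "buds N = h ` {d \<in> darts M. h d \<in> buds N}"
    using half_edges_darts[of N] unfolding image[symmetric] by auto
  moreover have "{d \<in> darts M. h d \<in> leaves N} = leaves M" "{d \<in> darts M. h d \<in> buds N} = buds M"
    using leaves_iso buds_iso half_edges_darts[of M] by auto
  moreover have "inj_on h (leaves M)" "inj_on h (buds M)"
    using inj half_edges_darts[of M] by (simp_all add: inj_on_subset)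
  ultimately show ?thesis by (simp add: total_charge_def card_image)
qed

private lemma walk_iso: "d \<in> darts M \<Longrightarrow> walk N (h d) = h (walk M d)"
  by (simp add: walk_def opp_iso rot_iso closed)

private lemma funpow_walk_iso: "d \<in> darts M \<Longrightarrow> (walk N ^^ n) (h d) = h ((walk M ^^ n) d)"
proof (induction n)
  case (Suc n)
  then show ?case by (simp add: walk_iso closed)
qed simp

private lemma height_iso: "d \<in> darts M \<Longrightarrow> height N (h d) n = height M d n"
  unfolding height_def
  by (intro sum.cong) (simp_all add: funpow_walk_iso weight_def leaves_iso buds_iso closed)

lemma matched_iso: "b \<in> darts M \<Longrightarrow> l \<in> darts M \<Longrightarrow> matched N (h b) (h l) \<longleftrightarrow> matched M b l"
  by (simp add: matched_def arch_def height_iso buds_iso funpow_walk_iso closed inj_on_eq_iff[OF inj])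

text \<open>Runs of the process are not transported; the arches are. The characterisation by arches
  needs positive total charge, and otherwise neither tree is balanced by definition.\<close>

lemma balanced_iso: "balanced N \<longleftrightarrow> balanced M"
proof (cases "total_charge M \<ge> 1")
  case True
  have r: "root_dart M \<in> darts M" using M by (simp add: rooted_map_def half_edges_def)
  have "(\<exists>b. matched N b (root_dart N)) \<longleftrightarrow> (\<exists>b. matched M b (root_dart M))"
    using matched_iso[OF _ r] image root_iso half_edges_darts matched_bud by (metis imageE subsetD)
  then show ?thesis
    using True r
    by (simp add: balanced_def total_charge_iso single_iff_not_matched M N leaves_iso root_iso)
qed (simp add: balanced_def total_charge_iso)

private lemma vertices_iso: "vertices N = (`) h ` vertices M"
proof -
  have "orbit (rot N) (h d) = h ` orbit (rot M) d" if "d \<in> darts M" for d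
  proof (rule orbit_inverse[symmetric])
    show "d \<in> orbit (rot M) d" using orbit_eq_iff[OF rotM finD] by simp
    show "rot N (h x) = h (rot M x)" if "x \<in> orbit (rot M) d" for x
      using that permutes_orbit_subset[OF rotM \<open>d \<in> darts M\<close>] rot_iso by blast
  qed
  then show ?thesis unfolding vertices_def image[symmetric] by (simp add: image_image)
qed

private lemma vertex_darts: "v \<in> vertices M \<Longrightarrow> v \<subseteq> darts M"
  using permutes_orbit_subset[OF rotM] by (fastforce simp: vertices_def)

private lemma card_vertex_iso: "v \<in> vertices M \<Longrightarrow> card (h ` v) = card v"
  using vertex_darts inj by (meson card_image inj_on_subset)

lemma degrees_multiples_of_iso: "degrees_multiples_of m N \<longleftrightarrow> degrees_multiples_of m M"
  by (simp add: degrees_multiples_of_def vertices_iso card_vertex_iso)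

private lemma degrees_iso:
  assumes "\<And>d. d \<in> darts M \<Longrightarrow> Q (h d) \<longleftrightarrow> P d"
  shows "image_mset card (mset_set {v \<in> vertices N. \<forall>d \<in> v. Q d})
       = image_mset card (mset_set {v \<in> vertices M. \<forall>d \<in> v. P d})"
proof -
  let ?V = "{v \<in> vertices M. \<forall>d \<in> v. P d}"
  have "(\<forall>d \<in> h ` v. Q d) \<longleftrightarrow> (\<forall>d \<in> v. P d)" if "v \<in> vertices M" for v
    using vertex_darts[OF that] assms by blast
  then have V: "{v \<in> vertices N. \<forall>d \<in> v. Q d} = (`) h ` ?V"
    unfolding vertices_iso by blast
  have "inj_on ((`) h) ?V"
    using inj_on_image_Pow[OF inj] by (rule inj_on_subset) (use vertex_darts in blast)
  then have "mset_set ((`) h ` ?V) = image_mset ((`) h) (mset_set ?V)"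
    by (rule image_mset_mset_set[symmetric])
  moreover have "finite ?V" using finD by (simp add: vertices_def)
  ultimately show ?thesis
    by (simp add: V multiset.map_comp) (intro image_mset_cong; simp add: card_vertex_iso)
qed

lemma white_degrees_iso: "white_degrees N = white_degrees M"
  and black_degrees_iso: "black_degrees N = black_degrees M"
  unfolding white_degrees_def black_degrees_def by (intro degrees_iso; simp add: white_iso)+

lemma reroot_iso: "is_iso h (reroot M r) (reroot N (h r))"
  using h by (simp add: is_iso_def)

lemma root_leaf_iso: "root_dart N \<in> leaves N \<longleftrightarrow> root_dart M \<in> leaves M"
  using leaves_iso[of "root_dart M"] M root_iso by (simp add: rooted_map_def half_edges_def)

end

section \<open>Maps and conditions on equivalence classes\<close>

lemma quotient_filter:
  assumes r: "equiv X r" and "A \<subseteq> X" and Q: "\<And>x y. (x, y) \<in> r \<Longrightarrow> Q x \<longleftrightarrow> Q y"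
  shows "{T \<in> A // r. \<forall>x\<in>T. Q x} = {x \<in> A. Q x} // r"
proof -
  have "(\<forall>y\<in>r `` {x}. Q y) \<longleftrightarrow> Q x" if "x \<in> A" for x
    using that assms(2) Q equiv_class_self[OF r] by blast
  then show ?thesis unfolding quotient_def by blast
qed

lemma quotient_disjoint:
  assumes r: "equiv X r" and "B \<subseteq> X" and "\<And>x y. (x, y) \<in> r \<Longrightarrow> x \<in> A \<Longrightarrow> y \<notin> B"
  shows "A // r \<inter> B // r = {}"
proof -
  have "r `` {x} \<noteq> r `` {y}" if "x \<in> A" "y \<in> B" for x y
    using that assms equiv_class_self[OF r, of y] by blast
  then show ?thesis unfolding quotient_def by blast
qed

text \<open>Intersecting the class with \<open>A\<close> applies \<open>g\<close> only to
  representatives on which it is controlled. Thus a class may leave \<open>A\<close>, and the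
  invariance of \<open>blossom_tree\<close> under isomorphism never has to be proved.\<close>

lemma quotient_map_class:
  assumes r: "equiv X r" and "A \<subseteq> X" and x: "x \<in> A"
    and g: "\<And>x y. x \<in> A \<Longrightarrow> y \<in> A \<Longrightarrow> (x, y) \<in> r \<Longrightarrow> (g x, g y) \<in> r"
  shows "r `` (g ` (r `` {x} \<inter> A)) = r `` {g x}"
proof -
  have "x \<in> r `` {x}" using assms(2) x equiv_class_self[OF r] by blast
  moreover have "r `` {g y} = r `` {g x}" if "y \<in> r `` {x} \<inter> A" for y
    using that g[OF x, of y] equiv_class_eq[OF r] by blast
  ultimately show ?thesis using x by blast
qed

lemma quotient_bij_betw:
  assumes r: "equiv X r" and X: "A \<subseteq> X" "B \<subseteq> X"
    and g: "\<And>x. x \<in> A \<Longrightarrow> g x \<in> B" "\<And>x. x \<in> A \<Longrightarrow> g' (g x) = x"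
      "\<And>x y. x \<in> A \<Longrightarrow> y \<in> A \<Longrightarrow> (x, y) \<in> r \<Longrightarrow> (g x, g y) \<in> r"
    and g': "\<And>x. x \<in> B \<Longrightarrow> g' x \<in> A" "\<And>x. x \<in> B \<Longrightarrow> g (g' x) = x"
      "\<And>x y. x \<in> B \<Longrightarrow> y \<in> B \<Longrightarrow> (x, y) \<in> r \<Longrightarrow> (g' x, g' y) \<in> r"
  shows "bij_betw (\<lambda>T. r `` (g ` (T \<inter> A))) (A // r) (B // r)"
proof -
  let ?F = "\<lambda>T. r `` (g ` (T \<inter> A))" and ?G = "\<lambda>T. r `` (g' ` (T \<inter> B))"
  have F: "?F (r `` {x}) = r `` {g x}" if "x \<in> A" for x
    using quotient_map_class[OF r X(1) that] g(3) by blast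
  have G: "?G (r `` {x}) = r `` {g' x}" if "x \<in> B" for x
    using quotient_map_class[OF r X(2) that] g'(3) by blast
  show ?thesis
  proof (rule bij_betw_byWitness[where f' = ?G])
    have "?G (?F T) = T \<and> ?F T \<in> B // r" if "T \<in> A // r" for T
    proof -
      obtain x where x: "x \<in> A" "T = r `` {x}" using \<open>T \<in> A // r\<close> by (rule quotientE)
      show ?thesis using F[OF x(1)] G[OF g(1)[OF x(1)]] g(1,2)[OF x(1)] x(2) by (simp add: quotientI)
    qed
    then show "\<forall>T\<in>A // r. ?G (?F T) = T" "?F ` (A // r) \<subseteq> B // r" by auto
    have "?F (?G T) = T \<and> ?G T \<in> A // r" if "T \<in> B // r" for T
    proof -
      obtain x where x: "x \<in> B" "T = r `` {x}" using \<open>T \<in> B // r\<close> by (rule quotientE)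
      show ?thesis using G[OF x(1)] F[OF g'(1)[OF x(1)]] g'(1,2)[OF x(1)] x(2) by (simp add: quotientI)
    qed
    then show "\<forall>T\<in>B // r. ?F (?G T) = T" "?G ` (B // r) \<subseteq> A // r" by auto
  qed
qed

section \<open>The bijection\<close>

definition white_trees :: "nat \<Rightarrow> cmap set" where
  "white_trees m = {M. blossom_tree M \<and> root_dart M \<in> leaves M \<and> charge M = int m - 1 \<and> degrees_multiples_of m M}"

definition black_trees :: "nat \<Rightarrow> cmap set" where
  "black_trees m = {M. blossom_tree M \<and> root_dart M \<in> buds M \<and> charge M = int m + 1 \<and> degrees_multiples_of m M}"

definition to_bud :: "cmap \<Rightarrow> cmap" where
  "to_bud M = reroot M (THE b. matched M b (root_dart M))"

definition to_leaf :: "cmap \<Rightarrow> cmap" where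
  "to_leaf M = reroot M (THE l. matched M (root_dart M) l)"

lemma blossom_tree_rooted_map: "blossom_tree M \<Longrightarrow> rooted_map M"
  by (simp add: blossom_tree_def tree_def)

lemma finite_darts: "rooted_map M \<Longrightarrow> finite (darts M)"
  by (simp add: rooted_map_def)

lemma to_bud_eq: "rooted_map M \<Longrightarrow> matched M b (root_dart M) \<Longrightarrow> to_bud M = reroot M b"
  unfolding to_bud_def
  by (subst the_equality[of _ b]) (auto intro: matched_unique_bud permutes_inj walk_permutes)

lemma to_leaf_eq: "matched M (root_dart M) l \<Longrightarrow> to_leaf M = reroot M l"
  unfolding to_leaf_def by (subst the_equality[of _ l]) (auto intro: matched_unique_leaf)

lemma matched_half_edges:
  assumes "matched M b l" shows "b \<in> half_edges M" "l \<in> half_edges M" "b \<in> darts M" "l \<in> darts M"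
  using matched_bud[OF assms] matched_leaf[OF assms] by (auto simp: buds_def leaves_def half_edges_def)

lemma white_trees_total: "M \<in> white_trees m \<Longrightarrow> total_charge M = int m"
  using charge_total(1)[of M] finite_darts[OF blossom_tree_rooted_map] by (auto simp: white_trees_def)

lemma black_trees_total: "M \<in> black_trees m \<Longrightarrow> total_charge M = int m"
  using charge_total(2)[of M] finite_darts[OF blossom_tree_rooted_map] by (auto simp: black_trees_def)

lemma unbalanced_matched:
  assumes "m \<ge> 1" "M \<in> white_trees m" "\<not> balanced M"
  shows "\<exists>b. matched M b (root_dart M)"
proof -
  have "total_charge M \<ge> 1" using assms white_trees_total by simp
  then show ?thesis
    using assms single_iff_not_matched[OF blossom_tree_rooted_map, of M]
    by (auto simp: balanced_def white_trees_def)
qed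

text \<open>The matching ignores the root, so after rerooting at the bud its partner is still the
  old root; this makes \<open>to_leaf\<close> undo the move.\<close>

lemma to_bud_black_tree:
  assumes "m \<ge> 1" "M \<in> white_trees m" "\<not> balanced M"
  shows "to_bud M \<in> black_trees m" "to_leaf (to_bud M) = M"
proof -
  obtain b where b: "matched M b (root_dart M)" using unbalanced_matched[OF assms] by blast
  have M: "blossom_tree M" "degrees_multiples_of m M" using assms(2) by (auto simp: white_trees_def)
  have eq: "to_bud M = reroot M b" using to_bud_eq[OF blossom_tree_rooted_map[OF M(1)] b] .
  have R: "blossom_tree (reroot M b)"
    using blossom_tree_reroot[OF M assms(1) white_trees_total[OF assms(2)]] matched_half_edges[OF b] by blast
  have "charge (reroot M b) = int m + 1"
    using charge_total(2)[OF finite_darts[OF blossom_tree_rooted_map[OF R]]] matched_bud[OF b]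
      white_trees_total[OF assms(2)] by simp
  then show "to_bud M \<in> black_trees m" using R M matched_bud[OF b] by (simp add: black_trees_def eq)
  show "to_leaf (to_bud M) = M" using to_leaf_eq[of "reroot M b" "root_dart M"] b eq by simp
qed

lemma to_leaf_white_tree:
  assumes "m \<ge> 1" "M \<in> black_trees m"
  shows "to_leaf M \<in> white_trees m" "\<not> balanced (to_leaf M)" "to_bud (to_leaf M) = M"
proof -
  have M: "blossom_tree M" "degrees_multiples_of m M" "root_dart M \<in> buds M"
    using assms(2) by (auto simp: black_trees_def)
  have k: "total_charge M \<ge> 1" using assms black_trees_total by simp
  obtain l where l: "matched M (root_dart M) l"
    using bud_matched[OF blossom_tree_rooted_map[OF M(1)] k M(3)] by blast
  have eq: "to_leaf M = reroot M l" using to_leaf_eq[OF l] .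
  have R: "blossom_tree (reroot M l)"
    using blossom_tree_reroot[OF M(1,2) assms(1) black_trees_total[OF assms(2)]] matched_half_edges[OF l] by blast
  note RM = blossom_tree_rooted_map[OF R]
  have "charge (reroot M l) = int m - 1"
    using charge_total(1)[OF finite_darts[OF RM]] matched_leaf[OF l] black_trees_total[OF assms(2)] by simp
  then show "to_leaf M \<in> white_trees m" using R M matched_leaf[OF l] by (simp add: white_trees_def eq)
  have "\<not> single (reroot M l) l" using single_iff_not_matched[OF RM] k l by auto
  then show "\<not> balanced (to_leaf M)" by (simp add: eq balanced_def)
  show "to_bud (to_leaf M) = M" using to_bud_eq[OF RM, of "root_dart M"] l eq by simp
qed

text \<open>An isomorphism carries the bud matched with one root to a bud matched with the other. By
  uniqueness it is the bud chosen there, so the same bijection of darts serves the rerooted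
  trees.\<close>

lemma to_bud_map_iso:
  assumes m: "m \<ge> 1" and M: "M \<in> white_trees m" "\<not> balanced M"
    and N: "N \<in> white_trees m" "\<not> balanced N" and iso: "(M, N) \<in> map_iso"
  shows "(to_bud M, to_bud N) \<in> map_iso"
proof -
  obtain h where R: "rooted_map M" "rooted_map N" and h: "is_iso h M N" using iso by (auto simp: map_iso_def)
  obtain b where b: "matched M b (root_dart M)" using unbalanced_matched[OF m M] by blast
  have "matched N (h b) (root_dart N)"
    using matched_iso[OF R h] matched_half_edges[OF b] b root_iso[OF R h] by simp
  then have "to_bud M = reroot M b" "to_bud N = reroot N (h b)" using to_bud_eq R b by blast+
  moreover have "rooted_map (to_bud M)" "rooted_map (to_bud N)"
    using to_bud_black_tree(1)[OF m] M N blossom_tree_rooted_map by (auto simp: black_trees_def)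
  ultimately show ?thesis using reroot_iso[OF R h] by (auto simp: map_iso_def)
qed

lemma to_leaf_map_iso:
  assumes m: "m \<ge> 1" and M: "M \<in> black_trees m" and N: "N \<in> black_trees m" and iso: "(M, N) \<in> map_iso"
  shows "(to_leaf M, to_leaf N) \<in> map_iso"
proof -
  obtain h where R: "rooted_map M" "rooted_map N" and h: "is_iso h M N" using iso by (auto simp: map_iso_def)
  have "total_charge M \<ge> 1" "root_dart M \<in> buds M"
    using m M black_trees_total by (auto simp: black_trees_def)
  then obtain l where l: "matched M (root_dart M) l" using bud_matched[OF R(1)] by blast
  have "matched N (root_dart N) (h l)"
    using matched_iso[OF R h] matched_half_edges[OF l] l root_iso[OF R h] by simp
  then have "to_leaf M = reroot M l" "to_leaf N = reroot N (h l)" using to_leaf_eq l by blast+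
  moreover have "rooted_map (to_leaf M)" "rooted_map (to_leaf N)"
    using to_leaf_white_tree(1)[OF m] M N blossom_tree_rooted_map by (auto simp: white_trees_def)
  ultimately show ?thesis using reroot_iso[OF R h] by (auto simp: map_iso_def)
qed

lemma map_iso_invariants:
  assumes "(M, N) \<in> map_iso"
  shows "degrees_multiples_of m M \<longleftrightarrow> degrees_multiples_of m N" "balanced M \<longleftrightarrow> balanced N"
    "white_degrees M = white_degrees N" "black_degrees M = black_degrees N"
    "root_dart M \<in> leaves M \<longleftrightarrow> root_dart N \<in> leaves N"
proof -
  obtain h where R: "rooted_map M" "rooted_map N" "is_iso h M N" using assms by (auto simp: map_iso_def)
  show "degrees_multiples_of m M \<longleftrightarrow> degrees_multiples_of m N" using degrees_multiples_of_iso[OF R] by simp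
  show "balanced M \<longleftrightarrow> balanced N" using balanced_iso[OF R] by simp
  show "white_degrees M = white_degrees N" using white_degrees_iso[OF R] by simp
  show "black_degrees M = black_degrees N" using black_degrees_iso[OF R] by simp
  show "root_dart M \<in> leaves M \<longleftrightarrow> root_dart N \<in> leaves N" using root_leaf_iso[OF R] by simp
qed

text \<open>A condition imposed on all members of a class can be tested on one representative, as it
  is invariant under isomorphism. This turns the families of classes into quotients of plain sets of
  trees.\<close>

lemma hat_quotient:
  assumes "\<And>M. P M \<Longrightarrow> rooted_map M"
  shows "hat m ({M. P M} // map_iso) = {M. P M \<and> degrees_multiples_of m M} // map_iso"
proof -
  have "{M. P M} \<subseteq> {M. rooted_map M}" using assms by blast
  from quotient_filter[OF equiv_map_iso this map_iso_invariants(1)[of _ _ m]]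
  show ?thesis by (simp add: hat_def)
qed

lemma hat_\<W>: "hat m (\<W> (int m - 1)) = white_trees m // map_iso"
  unfolding \<W>_def
  by (subst hat_quotient) (auto intro: blossom_tree_rooted_map simp: white_trees_def)

lemma hat_\<B>: "hat m (\<B> (int m + 1)) = black_trees m // map_iso"
  unfolding \<B>_def
  by (subst hat_quotient) (auto intro: blossom_tree_rooted_map simp: black_trees_def)

lemma white_trees_rooted: "white_trees m \<subseteq> {M. rooted_map M}"
  and black_trees_rooted: "black_trees m \<subseteq> {M. rooted_map M}"
  by (auto simp: white_trees_def black_trees_def blossom_tree_rooted_map)

lemma hat_\<W>_star: "hat m (\<W>_star (int m - 1)) = {M \<in> white_trees m. balanced M} // map_iso"
proof -
  have "hat m (\<W>_star (int m - 1)) = {T \<in> hat m (\<W> (int m - 1)). \<forall>M\<in>T. balanced M}"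
    by (auto simp: hat_def \<W>_star_def)
  then show ?thesis
    using quotient_filter[OF equiv_map_iso white_trees_rooted, of balanced m] map_iso_invariants(2)
    by (simp add: hat_\<W>)
qed

theorem theorem13:
  fixes m :: nat
  assumes "m \<ge> 1"
  shows "hat m (\<W>_star (int m - 1)) \<inter> hat m (\<B> (int m + 1)) = {} \<and>
    (\<exists>f. bij_betw f (hat m (\<W> (int m - 1)))
            (hat m (\<W>_star (int m - 1)) \<union> hat m (\<B> (int m + 1))) \<and>
         degree_preserving (hat m (\<W> (int m - 1))) f)"
proof -
  let ?P = "{M \<in> white_trees m. balanced M}" and ?U = "{M \<in> white_trees m. \<not> balanced M}"
  let ?F = "\<lambda>T. map_iso `` (to_bud ` (T \<inter> ?U))"
  have rooted: "?P \<subseteq> {M. rooted_map M}" "?U \<subseteq> {M. rooted_map M}" using white_trees_rooted by auto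
  have W: "white_trees m // map_iso = ?P // map_iso \<union> ?U // map_iso"
    unfolding quotient_def by blast
  have PU: "?P // map_iso \<inter> ?U // map_iso = {}"
    by (rule quotient_disjoint[OF equiv_map_iso rooted(2)]) (simp add: map_iso_invariants(2))
  have PB: "?P // map_iso \<inter> black_trees m // map_iso = {}"
  proof (rule quotient_disjoint[OF equiv_map_iso black_trees_rooted])
    fix M N assume "(M, N) \<in> map_iso" "M \<in> ?P"
    then have "root_dart N \<in> leaves N" using map_iso_invariants(5) by (auto simp: white_trees_def)
    then show "N \<notin> black_trees m" using half_edges_split(2)[of N] by (auto simp: black_trees_def)
  qed
  have F_class: "?F (map_iso `` {M}) = map_iso `` {to_bud M}" if "M \<in> ?U" for M
    by (rule quotient_map_class[OF equiv_map_iso rooted(2) that]) (use to_bud_map_iso assms in blast)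
  have "bij_betw ?F (?U // map_iso) (black_trees m // map_iso)"
  proof (rule quotient_bij_betw[OF equiv_map_iso rooted(2) black_trees_rooted, where g' = to_leaf])
    show "to_bud M \<in> black_trees m" "to_leaf (to_bud M) = M" if "M \<in> ?U" for M
      using to_bud_black_tree[OF assms] that by simp_all
    show "to_leaf M \<in> ?U" "to_bud (to_leaf M) = M" if "M \<in> black_trees m" for M
      using to_leaf_white_tree[OF assms that] by simp_all
    show "(to_bud M, to_bud N) \<in> map_iso" if "M \<in> ?U" "N \<in> ?U" "(M, N) \<in> map_iso" for M N
      using to_bud_map_iso[OF assms] that by simp
    show "(to_leaf M, to_leaf N) \<in> map_iso"
      if "M \<in> black_trees m" "N \<in> black_trees m" "(M, N) \<in> map_iso" for M N
      using to_leaf_map_iso[OF assms that] .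
  qed
  \<comment> \<open>Balanced classes stay fixed and the others are rerooted. The two pieces glue
    because \<open>PU\<close> separates their domains and \<open>PB\<close> their images.\<close>
  then have bij: "bij_betw (\<lambda>T. if T \<in> ?P // map_iso then T else ?F T)
      (white_trees m // map_iso) (?P // map_iso \<union> black_trees m // map_iso)"
    using bij_betw_disjoint_Un[OF bij_betw_id[unfolded id_def], of ?F "?U // map_iso" "black_trees m // map_iso" "?P // map_iso"]
      PU PB W by simp
  have "degree_preserving (white_trees m // map_iso) (\<lambda>T. if T \<in> ?P // map_iso then T else ?F T)"
    unfolding degree_preserving_def
  proof (intro ballI)
    fix T M N
    assume T: "T \<in> white_trees m // map_iso" and M: "M \<in> T" and N: "N \<in> (if T \<in> ?P // map_iso then T else ?F T)"
    show "white_degrees N = white_degrees M \<and> black_degrees N = black_degrees M"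
    proof (cases "T \<in> ?P // map_iso")
      case True
      then obtain K where "T = map_iso `` {K}" by (auto elim: quotientE)
      then have "(K, M) \<in> map_iso" "(K, N) \<in> map_iso" using M N True by auto
      then show ?thesis using map_iso_invariants(3,4) by metis
    next
      case False
      then have "T \<in> ?U // map_iso" using T W by blast
      then obtain K where K: "K \<in> ?U" "T = map_iso `` {K}" by (auto elim: quotientE)
      then have "(K, M) \<in> map_iso" "(to_bud K, N) \<in> map_iso" using M N False F_class by auto
      \<comment> \<open>Rerooting leaves vertices and colours alone, so \<open>K\<close> and
        \<open>to_bud K\<close> have the same degrees; isomorphisms account for \<open>M\<close> and
        \<open>N\<close>.\<close>
      then show ?thesis using map_iso_invariants(3,4) by (metis to_bud_def reroot_invariants(11,12))
    qed
  qed
  then show ?thesis using bij PB unfolding hat_\<W> hat_\<W>_star hat_\<B> by blast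
qed

end
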